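(* Let $v_t$ be the hybrid stochastic estimator of $G$ at $x_t$ defined by $$v_t:=\beta_{t-1}v_{t-1}+\beta_{t-1}\big[G_{\xi_t}(x_t)-G_{\xi_t}(x_{t-1})\big]+(1-\beta_{t-1})u_t,$$ with a given weight $\beta_{t-1}\in[0,1]$ (see context). Then $$\mathbb{E}_{(\xi_t,\zeta_t)}[v_t]=G(x_t)+\beta_{t-1}\big[v_{t-1}-G(x_{t-1})\big].$$ If $\beta_{t-1}\neq0$, then $v_t$ is a biased estimator of $G(x_t)$. Moreover, $$\begin{aligned}\mathbb{E}_{(\xi_t,\zeta_t)}\big[\|v_t-G(x_t)\|^2\big]={}&\beta_{t-1}^2\|v_{t-1}-G(x_{t-1})\|^2-\beta_{t-1}^2\|G(x_t)-G(x_{t-1})\|^2\\&+\beta_{t-1}^2\,\mathbb{E}_{\xi_t}\big[\|G_{\xi_t}(x_t)-G_{\xi_t}(x_{t-1})\|^2\big]+(1-\beta_{t-1})^2\,\mathbb{E}_{\zeta_t}\big[\|u_t-G(x_t)\|^2\big].\end{aligned}$$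
   Context: $G(x):=\mathbb{E}_\xi[G_\xi(x)]$, where $G_\xi$ is a stochastic (vector) function from $\mathbb{R}^p\times\Omega$ to $\mathbb{R}^q$ depending on a random $\xi$ in a probability space $(\Omega,\mathbb{P})$. $\xi_t$ and $\zeta_t$ are two independent realizations of $\xi$. $u_t$ is an unbiased stochastic estimator of $G(x_t)$ formed by the realization $\zeta_t$, i.e. $\mathbb{E}_{\zeta_t}[u_t]=G(x_t)$ at the given $x_t$. $\mathbb{E}_{(\xi_t,\zeta_t)}$ denotes expectation with respect to $(\xi_t,\zeta_t)$, with $x_{t-1}$, $x_t$ and the previous estimator $v_{t-1}$ (determined by the earlier realizations) held fixed; $\mathbb{E}_{\xi_t}$ and $\mathbb{E}_{\zeta_t}$ are understood likewise.
   Formalization: The claim that v_t is biased whenever β_{t-1}≠0 fails if v_{t-1}=G(x_{t-1}), where the mean formula gives E[v_t]=G(x_t); it is replaced by: for β_{t-1}≠0, v_t is biased if and only if v_{t-1}≠G(x_{t-1}). *)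

theory Defs
  imports "HOL-Probability.Probability"
begin

definition mean_map :: "'w measure \<Rightarrow> ('w \<Rightarrow> 'x \<Rightarrow> 'y::{banach, second_countable_topology}) \<Rightarrow> 'x \<Rightarrow> 'y" where
  "mean_map P Gs x = (\<integral>s. Gs s x \<partial>P)"

definition hybrid_estimator ::
    "('w \<Rightarrow> 'x \<Rightarrow> 'y::real_vector) \<Rightarrow> real \<Rightarrow> 'x \<Rightarrow> 'x \<Rightarrow> 'y \<Rightarrow> 'w \<Rightarrow> 'y \<Rightarrow> 'y" where
  "hybrid_estimator Gs \<beta> xprev x vprev s u =
     \<beta> *\<^sub>R vprev + \<beta> *\<^sub>R (Gs s x - Gs s xprev) + (1 - \<beta>) *\<^sub>R u"

(* Integrability is part of both notions, since the Bochner integral of a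
   non-integrable function is 0 by convention. *)
definition unbiased_estimator ::
    "'a measure \<Rightarrow> ('a \<Rightarrow> 'y::{banach, second_countable_topology}) \<Rightarrow> 'y \<Rightarrow> bool" where
  "unbiased_estimator M X \<theta> \<longleftrightarrow> integrable M X \<and> (\<integral>\<omega>. X \<omega> \<partial>M) = \<theta>"

definition biased_estimator ::
    "'a measure \<Rightarrow> ('a \<Rightarrow> 'y::{banach, second_countable_topology}) \<Rightarrow> 'y \<Rightarrow> bool" where
  "biased_estimator M X \<theta> \<longleftrightarrow> integrable M X \<and> (\<integral>\<omega>. X \<omega> \<partial>M) \<noteq> \<theta>"

(* Expectation of a nonnegative random variable, with value infinity when it is not
   integrable; ereal rather than ennreal, so that real numbers can be subtracted. *)
definition nonneg_expectation :: "'a measure \<Rightarrow> ('a \<Rightarrow> real) \<Rightarrow> ereal" where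
  "nonneg_expectation M f = enn2ereal (\<integral>\<^sup>+\<omega>. ennreal (f \<omega>) \<partial>M)"

end

theory Submission
  imports Defs
begin

text \<open>With \<open>D = Gs \<xi> x - Gs \<xi> xprev\<close> and \<open>m = G x - G xprev\<close>, the error decomposes as
  \<open>v - G x = c + A + B\<close>, where \<open>c = \<beta> (vprev - G xprev)\<close> is constant and \<open>A = \<beta> (D - m)\<close>,
  \<open>B = (1 - \<beta>) (u - G x)\<close> are independent and centred. All cross terms in the expanded square are
  then integrable with mean zero, even if the second moments of \<open>A\<close> and \<open>B\<close> are infinite, so they
  drop out of the identity between extended nonnegative expectations.\<close>

text \<open>An integrable difference forces \<open>f\<close> and \<open>g\<close> to be both
  integrable or both not. In the first case linearity applies; in the second both nonnegative
  integrals are infinite. This lets second moments be compared without assuming that they are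
  finite.\<close>

lemma nn_integral_eq_if_integral_diff_eq_0:
  fixes f g :: "'a \<Rightarrow> real"
  assumes [measurable]: "f \<in> borel_measurable M" "g \<in> borel_measurable M"
    and nonneg: "\<And>x. 0 \<le> f x" "\<And>x. 0 \<le> g x"
    and int: "integrable M (\<lambda>x. f x - g x)" and zero: "(\<integral>x. f x - g x \<partial>M) = 0"
  shows "(\<integral>\<^sup>+x. ennreal (f x) \<partial>M) = (\<integral>\<^sup>+x. ennreal (g x) \<partial>M)"
proof (cases "integrable M g")
  case True
  then have f: "integrable M f"
    using Bochner_Integration.integrable_add[OF int True] by simp
  then have "(\<integral>x. f x \<partial>M) = (\<integral>x. g x \<partial>M)"
    using zero True by simp
  then show ?thesis
    using f True nonneg by (simp add: nn_integral_eq_integral)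
next
  case False
  then have "\<not> integrable M f"
    using Bochner_Integration.integrable_diff[OF _ int, of f] by auto
  then show ?thesis
    using False nonneg by (simp add: integrable_iff_bounded top.not_eq_extremum[symmetric])
qed

text \<open>Expanding the inner product over \<open>Basis\<close> reduces everything to products of
  independent real coordinates. For these, first moments suffice, so no square integrability
  enters.\<close>

lemma (in prob_space) indep_var_inner:
  fixes X Y :: "'a \<Rightarrow> 'b::euclidean_space"
  assumes indep: "indep_var borel X borel Y" and X: "integrable M X" and Y: "integrable M Y"
  shows "integrable M (\<lambda>\<omega>. X \<omega> \<bullet> Y \<omega>)"
    and "(\<integral>\<omega>. X \<omega> \<bullet> Y \<omega> \<partial>M) = (\<integral>\<omega>. X \<omega> \<partial>M) \<bullet> (\<integral>\<omega>. Y \<omega> \<partial>M)"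
proof -
  have inner_eq: "X \<omega> \<bullet> Y \<omega> = (\<Sum>b\<in>Basis. (X \<omega> \<bullet> b) * (Y \<omega> \<bullet> b))" for \<omega>
    by (rule euclidean_inner)
  have indep_comp: "indep_var borel (\<lambda>\<omega>. X \<omega> \<bullet> b) borel (\<lambda>\<omega>. Y \<omega> \<bullet> b)" for b
    using indep_var_compose[OF indep, of "\<lambda>z. z \<bullet> b" borel "\<lambda>z. z \<bullet> b" borel]
    by (simp add: comp_def)
  have int: "integrable M (\<lambda>\<omega>. (X \<omega> \<bullet> b) * (Y \<omega> \<bullet> b))" for b
    using X Y by (intro indep_var_integrable[OF indep_comp]) auto
  have "(\<integral>\<omega>. (X \<omega> \<bullet> b) * (Y \<omega> \<bullet> b) \<partial>M) = ((\<integral>\<omega>. X \<omega> \<partial>M) \<bullet> b) * ((\<integral>\<omega>. Y \<omega> \<partial>M) \<bullet> b)" for b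
    using X Y by (subst indep_var_lebesgue_integral[OF indep_comp]) auto
  with int show "(\<integral>\<omega>. X \<omega> \<bullet> Y \<omega> \<partial>M) = (\<integral>\<omega>. X \<omega> \<partial>M) \<bullet> (\<integral>\<omega>. Y \<omega> \<partial>M)"
    unfolding inner_eq by (subst euclidean_inner) simp
  show "integrable M (\<lambda>\<omega>. X \<omega> \<bullet> Y \<omega>)"
    unfolding inner_eq using int by simp
qed

theorem lemma1:
  fixes P :: "'w measure" and M :: "'a measure"
    and \<xi> \<zeta> :: "'a \<Rightarrow> 'w"
    and Gs :: "'w \<Rightarrow> real ^ 'p \<Rightarrow> real ^ 'q"
    and G :: "real ^ 'p \<Rightarrow> real ^ 'q"
    and U :: "'w \<Rightarrow> real ^ 'q"
    and xprev x :: "real ^ 'p" and vprev :: "real ^ 'q"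
    and \<beta> :: real
    and u v :: "'a \<Rightarrow> real ^ 'q"
  assumes "prob_space P" and "prob_space M"
    and "\<xi> \<in> M \<rightarrow>\<^sub>M P" and "distr M P \<xi> = P"
    and "\<zeta> \<in> M \<rightarrow>\<^sub>M P" and "distr M P \<zeta> = P"
    and "prob_space.indep_var M P \<xi> P \<zeta>"
    and "\<And>y. integrable P (\<lambda>s. Gs s y)"
    and "G = mean_map P Gs"
    and "U \<in> borel_measurable P"
    and "u = (\<lambda>\<omega>. U (\<zeta> \<omega>))"
    and "unbiased_estimator M u (G x)"
    and "0 \<le> \<beta>" and "\<beta> \<le> 1"
    and "v = (\<lambda>\<omega>. hybrid_estimator Gs \<beta> xprev x vprev (\<xi> \<omega>) (u \<omega>))"
  shows "integrable M v \<and>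
         (\<integral>\<omega>. v \<omega> \<partial>M) = G x + \<beta> *\<^sub>R (vprev - G xprev) \<and>
         (\<beta> \<noteq> 0 \<longrightarrow> (biased_estimator M v (G x) \<longleftrightarrow> vprev \<noteq> G xprev)) \<and>
         nonneg_expectation M (\<lambda>\<omega>. (norm (v \<omega> - G x))\<^sup>2) =
           ereal (\<beta>\<^sup>2 * (norm (vprev - G xprev))\<^sup>2) - ereal (\<beta>\<^sup>2 * (norm (G x - G xprev))\<^sup>2)
           + ereal (\<beta>\<^sup>2) * nonneg_expectation M (\<lambda>\<omega>. (norm (Gs (\<xi> \<omega>) x - Gs (\<xi> \<omega>) xprev))\<^sup>2)
           + ereal ((1 - \<beta>)\<^sup>2) * nonneg_expectation M (\<lambda>\<omega>. (norm (u \<omega> - G x))\<^sup>2)"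
proof -
  interpret prob_space M by fact
  note [measurable] = assms(3,5,10)
  have Gs_meas [measurable]: "(\<lambda>s. Gs s y) \<in> borel_measurable P" for y
    using assms(8) by auto
  define D where "D = (\<lambda>\<omega>. Gs (\<xi> \<omega>) x - Gs (\<xi> \<omega>) xprev)"
  define m where "m = G x - G xprev"
  define c where "c = \<beta> *\<^sub>R (vprev - G xprev)"
  define A where "A = (\<lambda>\<omega>. \<beta> *\<^sub>R (D \<omega> - m))"
  define B where "B = (\<lambda>\<omega>. (1 - \<beta>) *\<^sub>R (u \<omega> - G x))"

  \<comment> \<open>Since \<xi> has law \<open>P\<close>, integrals over \<open>P\<close> can be
    pulled back to \<open>M\<close>.\<close>
  have Gs_int: "integrable M (\<lambda>\<omega>. Gs (\<xi> \<omega>) y)" for y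
    using integrable_distr_eq[OF assms(3) Gs_meas] assms(4,8) by simp
  have Gs_mean: "(\<integral>\<omega>. Gs (\<xi> \<omega>) y \<partial>M) = G y" for y
    using integral_distr[OF assms(3) Gs_meas] assms(4,9) by (simp add: mean_map_def)
  have D_int: "integrable M D" and D_mean: "(\<integral>\<omega>. D \<omega> \<partial>M) = m"
    using Gs_int Gs_mean by (auto simp: D_def m_def)
  have u_int: "integrable M u" and u_mean: "(\<integral>\<omega>. u \<omega> \<partial>M) = G x"
    using assms(12) by (auto simp: unbiased_estimator_def)
  have A_int: "integrable M A" and A_mean: "(\<integral>\<omega>. A \<omega> \<partial>M) = 0"
    using D_int D_mean by (auto simp: A_def prob_space)
  have B_int: "integrable M B" and B_mean: "(\<integral>\<omega>. B \<omega> \<partial>M) = 0"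
    using u_int u_mean by (auto simp: B_def prob_space)

  have v_eq: "v \<omega> = G x + c + A \<omega> + B \<omega>" for \<omega>
    unfolding assms(15) hybrid_estimator_def A_def B_def c_def D_def m_def
    by (simp add: algebra_simps)
  have v_int: "integrable M v"
    unfolding v_eq[abs_def] using A_int B_int by simp
  have v_mean: "(\<integral>\<omega>. v \<omega> \<partial>M) = G x + c"
    unfolding v_eq using A_int B_int A_mean B_mean by (simp add: prob_space)

  \<comment> \<open>\<open>A\<close> depends on \<xi> alone and \<open>B\<close> on \<zeta> alone,
    so independence is inherited through measurable maps.\<close>
  have "indep_var borel ((\<lambda>s. \<beta> *\<^sub>R (Gs s x - Gs s xprev - m)) \<circ> \<xi>)
      borel ((\<lambda>s. (1 - \<beta>) *\<^sub>R (U s - G x)) \<circ> \<zeta>)"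
    by (rule indep_var_compose[OF assms(7)]) measurable
  then have AB_indep: "indep_var borel A borel B"
    by (simp add: A_def B_def D_def assms(11) comp_def)
  note AB_int = indep_var_inner(1)[OF AB_indep A_int B_int]
  have AB_mean: "(\<integral>\<omega>. A \<omega> \<bullet> B \<omega> \<partial>M) = 0"
    using indep_var_inner(2)[OF AB_indep A_int B_int] A_mean by simp

  \<comment> \<open>The subtracted term of the claim is moved to the left, so that \<open>f\<close>
    and \<open>g\<close> are both nonnegative and can be compared as extended integrals.\<close>
  define f where "f = (\<lambda>\<omega>. (norm (v \<omega> - G x))\<^sup>2 + \<beta>\<^sup>2 * (norm m)\<^sup>2)"
  define g where "g = (\<lambda>\<omega>. \<beta>\<^sup>2 * (norm (vprev - G xprev))\<^sup>2 + \<beta>\<^sup>2 * (norm (D \<omega>))\<^sup>2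
      + (1 - \<beta>)\<^sup>2 * (norm (u \<omega> - G x))\<^sup>2)"
  \<comment> \<open>The squared norms of \<open>c\<close>, \<open>A\<close>, \<open>B\<close> and
    \<open>\<beta> *\<^sub>R m\<close> all cancel. What remains is linear in \<open>A\<close>,
    linear in \<open>B\<close>, or the product of the two, hence integrable with mean zero.\<close>
  have diff: "f \<omega> - g \<omega> = 2 * ((c - \<beta> *\<^sub>R m) \<bullet> A \<omega> + c \<bullet> B \<omega> + A \<omega> \<bullet> B \<omega>)" for \<omega>
  proof -
    \<comment> \<open>\<open>D\<close> is not centred: its mean \<open>m\<close> is split off here,
      which is the source of the negative term in the claim.\<close>
    have D: "\<beta>\<^sup>2 * (norm (D \<omega>))\<^sup>2 = (norm (A \<omega> + \<beta> *\<^sub>R m))\<^sup>2"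
      by (simp add: A_def power_mult_distrib flip: scaleR_add_right)
    have u: "(1 - \<beta>)\<^sup>2 * (norm (u \<omega> - G x))\<^sup>2 = (norm (B \<omega>))\<^sup>2"
      by (simp add: B_def power_mult_distrib)
    have c: "\<beta>\<^sup>2 * (norm (vprev - G xprev))\<^sup>2 = (norm c)\<^sup>2"
      by (simp add: c_def power_mult_distrib)
    have m: "\<beta>\<^sup>2 * (norm m)\<^sup>2 = (norm (\<beta> *\<^sub>R m))\<^sup>2"
      by (simp add: power_mult_distrib)
    have v: "v \<omega> - G x = c + A \<omega> + B \<omega>"
      by (simp add: v_eq)
    show ?thesis
      unfolding f_def g_def D u c m v unfolding power2_norm_eq_inner
      \<comment> \<open>The deleted rules would pull \<beta> out of the inner products; without them
        \<open>\<beta> *\<^sub>R m\<close> stays a single vector.\<close>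
      by (simp add: inner_add_left inner_add_right inner_diff_left inner_commute
          algebra_simps del: inner_scaleR_left inner_scaleR_right)
  qed
  note [measurable] = borel_measurable_integrable[OF D_int] borel_measurable_integrable[OF u_int]
    borel_measurable_integrable[OF v_int]
  have "(\<integral>\<^sup>+\<omega>. ennreal (f \<omega>) \<partial>M) = (\<integral>\<^sup>+\<omega>. ennreal (g \<omega>) \<partial>M)"
  proof (rule nn_integral_eq_if_integral_diff_eq_0)
    show "f \<in> borel_measurable M" "g \<in> borel_measurable M"
      unfolding f_def g_def by measurable
    show "integrable M (\<lambda>\<omega>. f \<omega> - g \<omega>)"
      unfolding diff using A_int B_int AB_int by simp
    show "(\<integral>\<omega>. f \<omega> - g \<omega> \<partial>M) = 0"
      unfolding diff using A_int B_int AB_int A_mean B_mean AB_mean by simp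
  qed (auto simp: f_def g_def)
  then have "(\<integral>\<^sup>+\<omega>. ennreal ((norm (v \<omega> - G x))\<^sup>2) \<partial>M) + ennreal (\<beta>\<^sup>2 * (norm m)\<^sup>2) =
      ennreal (\<beta>\<^sup>2 * (norm (vprev - G xprev))\<^sup>2)
      + ennreal (\<beta>\<^sup>2) * (\<integral>\<^sup>+\<omega>. ennreal ((norm (D \<omega>))\<^sup>2) \<partial>M)
      + ennreal ((1 - \<beta>)\<^sup>2) * (\<integral>\<^sup>+\<omega>. ennreal ((norm (u \<omega> - G x))\<^sup>2) \<partial>M)"
    unfolding f_def g_def
    by (simp add: ennreal_mult nn_integral_add nn_integral_cmult emeasure_space_1)
  from arg_cong[OF this, of enn2ereal]
  have sum_eq: "nonneg_expectation M (\<lambda>\<omega>. (norm (v \<omega> - G x))\<^sup>2) + ereal (\<beta>\<^sup>2 * (norm m)\<^sup>2) =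
      ereal (\<beta>\<^sup>2 * (norm (vprev - G xprev))\<^sup>2)
      + ereal (\<beta>\<^sup>2) * nonneg_expectation M (\<lambda>\<omega>. (norm (D \<omega>))\<^sup>2)
      + ereal ((1 - \<beta>)\<^sup>2) * nonneg_expectation M (\<lambda>\<omega>. (norm (u \<omega> - G x))\<^sup>2)"
    by (simp only: nonneg_expectation_def plus_ennreal.rep_eq times_ennreal.rep_eq
        enn2ereal_ennreal mult_nonneg_nonneg zero_le_power2)
  \<comment> \<open>Only the real number \<open>a\<close> is moved across, so no difference of
    infinities arises even when \<open>p\<close>, \<open>q\<close> or \<open>r\<close> is
    infinite.\<close>
  have cancel: "p = ereal b - ereal a + q + r" if "p + ereal a = ereal b + q + r"
    for p q r :: ereal and a b
    using that by (cases p; cases q; cases r) auto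
  \<comment> \<open>The bias is exactly \<open>c\<close>, which for nonzero \<beta> vanishes only if
    the previous estimate was exact.\<close>
  have "biased_estimator M v (G x) \<longleftrightarrow> vprev \<noteq> G xprev" if "\<beta> \<noteq> 0"
    using that v_int v_mean by (simp add: biased_estimator_def c_def)
  then show ?thesis
    using v_int v_mean cancel[OF sum_eq] unfolding c_def D_def m_def by blast
qed

end
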